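(* For integers $n\ge 1$, $m$, $\ell$, let $\alpha_{n,m,\ell}$ be the number of elements $x\in \mathrm{Sym}(n)$ with $x^2=1$ whose disjoint cycle expression contains exactly $m$ transpositions and whose Coxeter length is $\ell$, and let $L_{n,m}(t)=\sum_{\ell=0}^{\infty}\alpha_{n,m,\ell}t^{\ell}$. Let $n\ge 3$ and $m\ge 1$. If $\ell<m$ then $\alpha_{n,m,\ell}=0$. If $\ell\ge m$ then $$\alpha_{n,m,\ell}=\alpha_{n-1,m,\ell}+\sum_{k=1}^{n-1}\alpha_{n-2,m-1,\ell+1-2k}.$$ Moreover $L_{n,0}(t)=1$, $L_{1,1}(t)=0$, $L_{2,1}(t)=t$, $L_{n,m}(t)=0$ for $n<2m$, and for all other positive integers $n,m$, $$L_{n,m}(t)=L_{n-1,m}(t)+\frac{t(t^{2n-2}-1)}{t^2-1}L_{n-2,m-1}(t).$$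
   Context: $\mathrm{Sym}(n)$ is identified with the Coxeter group $W(A_{n-1})$ whose fundamental reflections are the adjacent transpositions $(i\ i+1)$, $1\le i<n$ (for $n=1$ the group is trivial). The length of an element is the least number of fundamental reflections in an expression for it (the identity has length $0$); equivalently it is the number of inversions. The identity counts as an involution, so $\alpha_{n,0,0}=1$, $\alpha_{n,0,\ell}=0$ for $\ell\ne 0$, and $\alpha_{n,m,\ell}=0$ for $\ell<0$. *)

theory Defs
  imports
    "HOL-Combinatorics.Permutations"
    "HOL-Combinatorics.Cycles"
    "HOL-Computational_Algebra.Formal_Power_Series"
begin

text \<open>
  Sym(n) is the set of all \<open>x\<close> with \<open>x permutes {1..n}\<close>.  The word \<open>is\<close> stands for the product of
  the fundamental reflections \<open>(i i+1)\<close>, \<open>i \<in> {1..<n}\<close>; see \<^const>\<open>apply_adj_transps\<close>.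
\<close>

definition coxeter_length :: "nat \<Rightarrow> (nat \<Rightarrow> nat) \<Rightarrow> nat" where
  "coxeter_length n x =
     (LEAST k. \<exists>is. length is = k \<and> set is \<subseteq> {1..<n} \<and> apply_adj_transps is = x)"

text \<open>
  Fixed points are omitted from the expression.  It is unique up to the order of the cycles and
  the choice of the starting point of each cycle, so the number of its transpositions
  depends on the permutation only.
\<close>

definition disjoint_cycle_expression :: "(nat \<Rightarrow> nat) \<Rightarrow> nat list list \<Rightarrow> bool" where
  "disjoint_cycle_expression x cs \<longleftrightarrow>
     distinct (concat cs) \<and> (\<forall>c\<in>set cs. length c \<ge> 2) \<and>
     x = foldr (\<circ>) (map cycle_of_list cs) id"

definition has_transpositions :: "(nat \<Rightarrow> nat) \<Rightarrow> int \<Rightarrow> bool" where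
  "has_transpositions x m \<longleftrightarrow>
     (\<exists>cs. disjoint_cycle_expression x cs \<and> int (length (filter (\<lambda>c. length c = 2) cs)) = m)"

text \<open>
  The indices \<open>m\<close> and \<open>l\<close> are integers: negative values occur in the recurrence and give 0.
\<close>

definition alpha :: "nat \<Rightarrow> int \<Rightarrow> int \<Rightarrow> nat" where
  "alpha n m l =
     card {x. x permutes {1..n} \<and> x \<circ> x = id \<and> has_transpositions x m \<and>
              int (coxeter_length n x) = l}"

text \<open>
  Rational coefficients make \<open>t\<^sup>2 - 1\<close> a unit, so that division by it in the ring of
  power series is exact.
\<close>

definition L_series :: "nat \<Rightarrow> int \<Rightarrow> rat fps" where
  "L_series n m = Abs_fps (\<lambda>l. of_nat (alpha n m (int l)))"

end

theory Submission
  imports Defs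
begin

text \<open>
  Involutions \<open>x\<close> of \<open>{1..n}\<close> are sorted by the value \<open>j = x(n)\<close>.  Those with \<open>j = n\<close> are the
  involutions of \<open>{1..n-1}\<close>.  For \<open>1 \<le> j < n - 1\<close>, conjugation by \<open>(j j+1)\<close> moves the class of \<open>j\<close>
  onto that of \<open>j + 1\<close> and lowers the length by 2.  For \<open>j = n - 1\<close>, cancelling the transposition
  \<open>(n-1 n)\<close> lowers the length by 1 and leaves an involution of \<open>{1..n-2}\<close>.  Hence the class of
  \<open>j = n - k\<close> contributes the involutions of \<open>{1..n-2}\<close> with the length shifted by \<open>2k - 1\<close>, and
  summing \<open>t\<^sup>2\<^sup>k\<^sup>-\<^sup>1\<close> over \<open>k\<close> gives the rational factor.
\<close>

section \<open>Length and inversions\<close>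

text \<open>No bound \<open>n\<close> enters, so a permutation has the same inversions whether it is
  regarded in Sym(n) or in a larger group.\<close>

definition inversions :: "(nat \<Rightarrow> nat) \<Rightarrow> (nat \<times> nat) set" where
  "inversions w = {(i, j). i < j \<and> w j < w i}"

lemma inversions_id [simp]: "inversions id = {}"
  by (auto simp: inversions_def)

text \<open>Points outside the block are fixed, and they lie below or above all of it, so none of
  them takes part in an inversion.\<close>

lemma inversions_subset:
  assumes "w permutes {1..n}"
  shows "inversions w \<subseteq> {1..n} \<times> {1..n}"
proof
  fix p assume "p \<in> inversions w"
  then obtain i j where p: "p = (i, j)" "i < j" "w j < w i"
    by (auto simp: inversions_def)
  have fixed: "w k = k" if "k \<notin> {1..n}" for k
    using permutes_not_in[OF assms that] .
  have "i \<noteq> 0"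
    using p(3) fixed[of 0] by (intro notI) simp
  moreover have "j \<le> n"
  proof (rule ccontr)
    assume "\<not> j \<le> n"
    then have "w j = j"
      by (intro fixed) simp
    moreover have "w i \<le> n \<or> w i = i"
      using fixed[of i] permutes_in_image[OF assms, of i] by (meson atLeastAtMost_iff)
    ultimately show False
      using p(2,3) \<open>\<not> j \<le> n\<close> by linarith
  qed
  ultimately show "p \<in> {1..n} \<times> {1..n}"
    using p(1,2) by simp
qed

lemma finite_inversions:
  assumes "w permutes {1..n}"
  shows "finite (inversions w)"
  using inversions_subset[OF assms] by (rule finite_subset) simp

text \<open>Left multiplication by \<open>(a a+1)\<close> exchanges two neighbouring values, so only
  the relative order at the two positions holding them changes. That pair is an inversion before and
  none afterwards.\<close>

lemma inversions_transpose_comp: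
  assumes "inj w" "b < c" "w b = Suc a" "w c = a"
  shows "inversions w = insert (b, c) (inversions (transpose a (Suc a) \<circ> w))"
    and "(b, c) \<notin> inversions (transpose a (Suc a) \<circ> w)"
proof -
  have *: "w i = a \<longleftrightarrow> i = c" "w i = Suc a \<longleftrightarrow> i = b" for i
    using assms by (metis injD)+
  show "(b, c) \<notin> inversions (transpose a (Suc a) \<circ> w)"
    using assms by (auto simp: inversions_def)
  show "inversions w = insert (b, c) (inversions (transpose a (Suc a) \<circ> w))"
  proof (intro set_eqI)
    fix p :: "nat \<times> nat"
    obtain i j where p: "p = (i, j)"
      by force
    have "w i \<noteq> w j" if "i < j"
      using that assms(1) by (metis injD less_irrefl)
    then show "p \<in> inversions w \<longleftrightarrow> p \<in> insert (b, c) (inversions (transpose a (Suc a) \<circ> w))"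
      using assms(2-4) * [of i] *[of j] unfolding p inversions_def
      by (auto simp: transpose_def split: if_splits)
  qed
qed

lemma card_inversions_transpose_comp:
  assumes "w permutes {1..n}" "b < c" "w b = Suc a" "w c = a"
  shows "card (inversions w) = Suc (card (inversions (transpose a (Suc a) \<circ> w)))"
proof -
  note eq = inversions_transpose_comp[OF permutes_inj[OF assms(1)] assms(2-4)]
  have "finite (inversions (transpose a (Suc a) \<circ> w))"
    using finite_inversions[OF assms(1)] eq(1) by simp
  then show ?thesis
    using eq by simp
qed

text \<open>Exchanging the roles of positions and values carries inversions to inversions. This
  gives access to right multiplication by a reflection.\<close>

lemma card_inversions_inverse:
  assumes "w \<circ> v = id" "v \<circ> w = id"
  shows "card (inversions v) = card (inversions w)"
proof -
  have *: "w (v i) = i" "v (w i) = i" for i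
    using assms by (metis comp_apply id_apply)+
  have "bij_betw (\<lambda>(i, j). (v j, v i)) (inversions v) (inversions w)"
    by (rule bij_betw_byWitness[where f' = "\<lambda>(i, j). (w j, w i)"])
       (auto simp: inversions_def *)
  then show ?thesis
    by (rule bij_betw_same_card)
qed

lemma transpose_Suc_permutes:
  assumes "a \<in> {1..<n}"
  shows "transpose a (Suc a) permutes {1..n}"
  using assms by (intro permutes_swap_id) auto

lemma apply_adj_transps_permutes:
  assumes "set is \<subseteq> {1..<n}"
  shows "apply_adj_transps is permutes {1..n}"
  using assms by (intro permutes_apply_adj_transps) auto

text \<open>Each letter of a word changes the number of inversions by one, up or down, which bounds
  the length from below.\<close>

lemma card_inversions_le_length:
  assumes "set is \<subseteq> {1..<n}"
  shows "card (inversions (apply_adj_transps is)) \<le> length is"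
  using assms
proof (induction "is")
  case (Cons a "is")
  define w where "w = apply_adj_transps is"
  define s where "s = transpose a (Suc a)"
  have w: "w permutes {1..n}" and a: "a \<in> {1..<n}"
    using Cons.prems apply_adj_transps_permutes unfolding w_def by auto
  have sw: "s \<circ> w permutes {1..n}"
    using permutes_compose[OF w transpose_Suc_permutes[OF a]] unfolding s_def .
  obtain b c where bc: "w b = Suc a" "w c = a"
    using permutes_surj[OF w] by (metis surjD)
  have "card (inversions (s \<circ> w)) \<le> Suc (card (inversions w))"
  proof (cases "b < c")
    case True
    show ?thesis
      using card_inversions_transpose_comp[OF w True bc] unfolding s_def by simp
  next
    case False
    with bc have "c < b"
      by (metis linorder_neqE_nat n_not_Suc_n)
    \<comment> \<open>Here the inversion belongs to \<open>s \<circ> w\<close>, where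
      \<open>c\<close> holds \<open>a + 1\<close> and \<open>b\<close> holds \<open>a\<close>; the
      lemma on removing an inversion is applied to that permutation.\<close>
    moreover have "s \<circ> (s \<circ> w) = w"
      by (auto simp: s_def)
    ultimately show ?thesis
      using card_inversions_transpose_comp[OF sw, of c b a] bc by (simp add: s_def)
  qed
  moreover have "card (inversions w) \<le> length is"
    using Cons by (simp add: w_def)
  ultimately show ?case
    by (simp add: w_def[symmetric] s_def[symmetric] del: o_apply)
qed simp

text \<open>Otherwise the inverse increases along the block, hence never falls below the identity,
  hence equals it. The inverse is used because words grow on the left, where a reflection exchanges
  values.\<close>

lemma exists_descent:
  assumes "x permutes {1..n}" "x \<noteq> id"
  obtains a where "a \<in> {1..<n}" "inv x (Suc a) < inv x a"
proof -
  have ix: "inv x permutes {1..n}"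
    using assms(1) by (rule permutes_inv)
  have "\<exists>a\<in>{1..<n}. inv x (Suc a) < inv x a"
  proof (rule ccontr)
    assume *: "\<not> ?thesis"
    have mono: "inv x a < inv x (Suc a)" if "a \<in> {1..<n}" for a
    proof -
      have "inv x a \<noteq> inv x (Suc a)"
        using permutes_inj[OF ix] by (metis injD n_not_Suc_n)
      then show ?thesis
        using * that by force
    qed
    have ge: "Suc a \<le> n \<longrightarrow> Suc a \<le> inv x (Suc a)" for a
    proof (induction a)
      case 0
      then show ?case
        using permutes_in_image[OF ix, of 1] by auto
    next
      case (Suc a)
      then show ?case
        using mono[of "Suc a"] by auto
    qed
    have "i \<le> inv x i" if "i \<in> {1..n}" for i
      using ge[of "i - 1"] that by auto
    then have "inv x = id"
      using permutes_natset_ge[OF ix] by blast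
    then show False
      using assms by (metis inv_id permutes_inv_inv)
  qed
  then show ?thesis
    using that by blast
qed

text \<open>Bubble sort: at a descent of the inverse a reflection removes exactly one inversion, and
  this is repeated until the identity is reached.\<close>

lemma exists_word_card_inversions:
  assumes "x permutes {1..n}"
  shows "\<exists>is. length is = card (inversions x) \<and> set is \<subseteq> {1..<n} \<and> apply_adj_transps is = x"
  using assms
proof (induction "card (inversions x)" arbitrary: x rule: less_induct)
  case less
  show ?case
  proof (cases "x = id")
    case True
    then show ?thesis
      by (intro exI[of _ "[]"]) auto
  next
    case False
    obtain a where a: "a \<in> {1..<n}" "inv x (Suc a) < inv x a"
      using exists_descent[OF less.prems False] by blast
    define s where "s = transpose a (Suc a)"
    have card: "card (inversions x) = Suc (card (inversions (s \<circ> x)))"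
      using card_inversions_transpose_comp[OF less.prems a(2)] permutes_inverses(1)[OF less.prems]
      unfolding s_def by blast
    moreover have "s \<circ> x permutes {1..n}"
      using permutes_compose[OF less.prems transpose_Suc_permutes[OF a(1)]] unfolding s_def .
    ultimately obtain "is" where
      "is": "length is = card (inversions (s \<circ> x))" "set is \<subseteq> {1..<n}" "apply_adj_transps is = s \<circ> x"
      using less.hyps[of "s \<circ> x"] by auto
    have "s \<circ> (s \<circ> x) = x"
      by (auto simp: s_def)
    then show ?thesis
      using "is" card a(1) by (intro exI[of _ "a # is"]) (simp add: s_def)
  qed
qed

lemma coxeter_length_eq_card_inversions:
  assumes "x permutes {1..n}"
  shows "coxeter_length n x = card (inversions x)"
  unfolding coxeter_length_def
proof (rule Least_equality)
  show "\<exists>is. length is = card (inversions x) \<and> set is \<subseteq> {1..<n} \<and> apply_adj_transps is = x"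
    using assms by (rule exists_word_card_inversions)
qed (use card_inversions_le_length in blast)


section \<open>Transpositions of an involution\<close>

lemma foldr_cycles_outside:
  assumes "a \<notin> set (concat cs)"
  shows "foldr (\<circ>) (map cycle_of_list cs) id a = a"
  using assms by (induction cs) (auto simp: id_outside_supp)

text \<open>Factors to the right of \<open>c\<close> fix \<open>a\<close>; factors to the left fix
  its image, which stays in \<open>c\<close>.\<close>

lemma foldr_cycles_on_cycle:
  assumes "distinct (concat cs)" "c \<in> set cs" "a \<in> set c"
  shows "foldr (\<circ>) (map cycle_of_list cs) id a = cycle_of_list c a"
  using assms
proof (induction cs)
  case (Cons d cs)
  show ?case
  proof (cases "a \<in> set d")
    case True
    then have "a \<notin> set (concat cs)"
      using Cons.prems(1) by auto
    moreover from this have "c = d"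
      using Cons.prems by auto
    ultimately show ?thesis
      using foldr_cycles_outside[of a cs] by (metis comp_apply foldr_Cons list.simps(9))
  next
    case False
    then have c: "c \<in> set cs"
      using Cons.prems by auto
    have "cycle_of_list c a \<in> set c"
      using permutes_in_image[OF cycle_permutes] Cons.prems(3) by metis
    then have "cycle_of_list c a \<notin> set d"
      using Cons.prems(1) c by auto
    then show ?thesis
      using Cons.IH Cons.prems c by (simp add: id_outside_supp)
  qed
qed simp

text \<open>In a cycle \<open>a # b # d\<close> the point after \<open>b\<close> is the head of
  \<open>d @ [a]\<close>. It must be \<open>a\<close> since \<open>x\<close> is an involution, and
  distinctness then leaves \<open>d\<close> empty.\<close>

lemma disjoint_cycle_expression_involution:
  assumes "disjoint_cycle_expression x cs" "x \<circ> x = id"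
  shows "\<forall>c\<in>set cs. length c = 2" and "card {i. x i \<noteq> i} = 2 * length cs"
proof -
  have dist: "distinct (concat cs)" and len: "\<And>c. c \<in> set cs \<Longrightarrow> 2 \<le> length c"
    and x: "x = foldr (\<circ>) (map cycle_of_list cs) id"
    using assms(1) unfolding disjoint_cycle_expression_def by auto
  have two: "\<exists>a b. c = [a, b] \<and> a \<noteq> b \<and> x a = b \<and> x b = a" if c: "c \<in> set cs" for c
  proof -
    have "distinct c"
      using dist c by (auto simp: distinct_concat_iff)
    obtain a b d where abd: "c = a # b # d"
      using len[OF c] by (cases c rule: cycle_of_list.cases) auto
    have rot: "map x c = rotate1 c"
      using cyclic_rotation[OF \<open>distinct c\<close>, of 1] foldr_cycles_on_cycle[OF dist c]
      by (simp add: x cong: map_cong)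
    have "x a = b" "x b = hd (d @ [a])"
      using rot abd by (cases d; simp)+
    moreover have "x (x a) = a"
      using assms(2) by (metis comp_apply id_apply)
    ultimately have "d = []"
      using abd \<open>distinct c\<close> by (cases d) auto
    then show ?thesis
      using abd \<open>distinct c\<close> \<open>x a = b\<close> \<open>x b = hd (d @ [a])\<close> by auto
  qed
  show *: "\<forall>c\<in>set cs. length c = 2"
    using two by fastforce
  have "{i. x i \<noteq> i} = set (concat cs)"
  proof
    show "{i. x i \<noteq> i} \<subseteq> set (concat cs)"
      using foldr_cycles_outside[of _ cs] unfolding x[symmetric] by blast
    show "set (concat cs) \<subseteq> {i. x i \<noteq> i}"
      using two by fastforce
  qed
  then have "card {i. x i \<noteq> i} = length (concat cs)"
    using distinct_card[OF dist] by simp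
  also have "\<dots> = 2 * length cs"
    using * by (induction cs) auto
  finally show "card {i. x i \<noteq> i} = 2 * length cs" .
qed

lemma exists_disjoint_cycle_expression_involution:
  assumes "finite {i. x i \<noteq> i}" "x \<circ> x = id"
  shows "\<exists>cs. disjoint_cycle_expression x cs"
proof -
  have xx: "x (x i) = i" for i
    using assms(2) by (metis comp_apply id_apply)
  have "finite {i. i < x i}"
    using assms(1) by (rule rev_finite_subset) auto
  then obtain js where js: "set js = {i. i < x i}" "distinct js"
    using finite_distinct_list by blast
  \<comment> \<open>Only the smaller point of each transposition starts a cycle, so no transposition
    is listed twice.\<close>
  define cs where "cs = map (\<lambda>i. [i, x i]) js"
  have inj: "i = j" if "x i = x j" for i j
    using that xx by metis
  have "distinct (concat (map (\<lambda>i. [i, x i]) ks))" if "set ks \<subseteq> {i. i < x i}" "distinct ks" for ks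
    using that
  proof (induction ks)
    case (Cons k ks)
    have "k < x k"
      using Cons.prems by simp
    have "k \<noteq> x i \<and> x k \<noteq> i \<and> x k \<noteq> x i" if "i \<in> set ks" for i
    proof (intro conjI)
      have "i < x i" "i \<noteq> k"
        using Cons.prems that by auto
      show "k \<noteq> x i"
        using \<open>i < x i\<close> \<open>k < x k\<close> by (metis less_asym xx)
      show "x k \<noteq> i"
        using \<open>i < x i\<close> \<open>k < x k\<close> by (metis less_asym xx)
      show "x k \<noteq> x i"
        using \<open>i \<noteq> k\<close> inj by metis
    qed
    then show ?case
      using Cons \<open>k < x k\<close> by fastforce
  qed simp
  then have dist: "distinct (concat cs)"
    using js by (simp add: cs_def)
  have "x a = foldr (\<circ>) (map cycle_of_list cs) id a" for a
  proof (cases "a \<in> set (concat cs)")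
    case True
    then obtain i where i: "i \<in> set js" "a \<in> set [i, x i]"
      by (auto simp: cs_def)
    then show ?thesis
      using foldr_cycles_on_cycle[OF dist, of "[i, x i]" a] xx[of i] by (auto simp: cs_def)
  next
    case False
    have "x a = a"
    proof (rule ccontr)
      assume "x a \<noteq> a"
      then have "a \<in> set js \<or> x a \<in> set js"
        unfolding js(1) mem_Collect_eq xx by linarith
      moreover have "a \<in> set [x a, x (x a)]"
        by (simp add: xx)
      ultimately have "a \<in> set (concat cs)"
        unfolding cs_def by auto
      then show False
        using False by blast
    qed
    then show ?thesis
      using foldr_cycles_outside[OF False] by simp
  qed
  then have "x = foldr (\<circ>) (map cycle_of_list cs) id"
    by (rule ext)
  moreover have "\<forall>c\<in>set cs. length c \<ge> 2"
    by (auto simp: cs_def)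
  ultimately show ?thesis
    using dist unfolding disjoint_cycle_expression_def by blast
qed

text \<open>This replaces cycle expressions by the size of the support, which is easy to follow
  through conjugation and cancellation.\<close>

lemma has_transpositions_involution_iff:
  assumes "finite {i. x i \<noteq> i}" "x \<circ> x = id"
  shows "has_transpositions x m \<longleftrightarrow> int (card {i. x i \<noteq> i}) = 2 * m"
proof -
  have *: "2 * length (filter (\<lambda>c. length c = 2) cs) = card {i. x i \<noteq> i}"
    if "disjoint_cycle_expression x cs" for cs
    using disjoint_cycle_expression_involution[OF that assms(2)] by (simp cong: filter_cong)
  show ?thesis
    using exists_disjoint_cycle_expression_involution[OF assms] *
    unfolding has_transpositions_def by (force dest: *)
qed


section \<open>Counting involutions\<close>

definition involutions :: "nat \<Rightarrow> int \<Rightarrow> int \<Rightarrow> (nat \<Rightarrow> nat) set" where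
  "involutions n m l = {x. x permutes {1..n} \<and> x \<circ> x = id \<and>
     int (card {i. x i \<noteq> i}) = 2 * m \<and> int (card (inversions x)) = l}"

lemma support_subset:
  assumes "x permutes S"
  shows "{i. x i \<noteq> i} \<subseteq> S"
  using permutes_not_in[OF assms] by auto

lemma alpha_eq_card_involutions: "alpha n m l = card (involutions n m l)"
proof -
  have "finite {i. x i \<noteq> i}" if "x permutes {1..n}" for x
    using support_subset[OF that] by (rule finite_subset) simp
  then show ?thesis
    unfolding alpha_def involutions_def
    by (intro arg_cong[of _ _ card] Collect_cong)
       (auto simp: coxeter_length_eq_card_inversions has_transpositions_involution_iff)
qed

lemma finite_involutions: "finite (involutions n m l)"
  unfolding involutions_def by (rule finite_subset[OF _ finite_permutations[of "{1..n}"]]) auto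

lemma alpha_zero: "alpha n 0 l = (if l = 0 then 1 else 0)"
proof -
  have "x = id" if "x permutes {1..n}" "card {i. x i \<noteq> i} = 0" for x :: "nat \<Rightarrow> nat"
  proof -
    \<comment> \<open>An infinite set has \<open>card\<close> 0 as well, so finiteness is settled
      first.\<close>
    have "finite {i. x i \<noteq> i}"
      using support_subset[OF that(1)] by (rule finite_subset) simp
    then show ?thesis
      using that(2) by (auto simp: fun_eq_iff)
  qed
  then have "x \<in> involutions n 0 l \<longleftrightarrow> x = id \<and> l = 0" for x
    unfolding involutions_def using permutes_id by fastforce
  then have "involutions n 0 l = (if l = 0 then {id} else {})"
    by auto
  then show ?thesis
    by (simp add: alpha_eq_card_involutions)
qed

lemma alpha_eq_0_if_lt_double:
  assumes "int n < 2 * m"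
  shows "alpha n m l = 0"
proof -
  have "card {i. x i \<noteq> i} \<le> n" if "x permutes {1..n}" for x
    using card_mono[OF _ support_subset[OF that]] by simp
  then have "involutions n m l = {}"
    using assms unfolding involutions_def by force
  then show ?thesis
    by (simp add: alpha_eq_card_involutions)
qed

lemma alpha_eq_0_if_neg:
  assumes "l < 0"
  shows "alpha n m l = 0"
  using assms by (auto simp: alpha_def)

text \<open>Each transposition \<open>(i x(i))\<close> with \<open>i < x(i)\<close> is itself an inversion.\<close>

lemma card_support_le:
  assumes "x permutes {1..n}" "x \<circ> x = id"
  shows "card {i. x i \<noteq> i} \<le> 2 * card (inversions x)"
proof -
  define P where "P = {i. i < x i}"
  have xx: "x (x i) = i" for i
    using assms(2) by (metis comp_apply id_apply)
  have "finite P"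
    unfolding P_def by (rule finite_subset[OF _ finite_subset[OF support_subset[OF assms(1)]]]) auto
  have "{i. x i \<noteq> i} \<subseteq> P \<union> x ` P"
  proof
    fix i assume "i \<in> {i. x i \<noteq> i}"
    then have "i \<in> P \<or> x i \<in> P"
      by (auto simp: P_def xx)
    then show "i \<in> P \<union> x ` P"
      by (metis UnCI image_eqI xx)
  qed
  then have "card {i. x i \<noteq> i} \<le> card (P \<union> x ` P)"
    using \<open>finite P\<close> by (intro card_mono) auto
  also have "\<dots> \<le> card P + card P"
    using card_Un_le[of P "x ` P"] card_image_le[OF \<open>finite P\<close>, of x] by linarith
  also have "card P \<le> card (inversions x)"
    using finite_inversions[OF assms(1)]
    by (intro card_inj_on_le[where f = "\<lambda>i. (i, x i)"]) (auto simp: inj_on_def P_def inversions_def xx)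
  finally show ?thesis
    by simp
qed

lemma alpha_eq_0_if_less:
  assumes "l < m"
  shows "alpha n m l = 0"
proof -
  have "involutions n m l = {}"
    using assms card_support_le unfolding involutions_def by force
  then show ?thesis
    by (simp add: alpha_eq_card_involutions)
qed


section \<open>The recurrence\<close>

text \<open>Multiplication by \<open>s\<close> on the left and then on the right removes one
  inversion each time. In both cases position \<open>n\<close> holds the value \<open>j\<close>, and
  the value \<open>j + 1\<close> stands before it.\<close>

lemma card_inversions_conj:
  assumes x: "x permutes {1..n}" "x \<circ> x = id" and j: "1 \<le> j" "Suc j < n" and "x n = j"
  defines "s \<equiv> transpose j (Suc j)"
  shows "card (inversions x) = card (inversions (s \<circ> x \<circ> s)) + 2"
proof -
  have xx: "x (x i) = i" for i
    using x(2) by (metis comp_apply id_apply)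
  have ss: "s \<circ> s = id"
    by (simp add: s_def)
  have s: "s permutes {1..n}"
    unfolding s_def using j by (intro transpose_Suc_permutes) auto
  have "x j = n"
    using xx \<open>x n = j\<close> by metis
  \<comment> \<open>As \<open>x\<close> is an involution, \<open>q\<close> is the position of the
    value \<open>j + 1\<close>.\<close>
  define q where "q = x (Suc j)"
  have "q \<noteq> n"
    using xx[of "Suc j"] \<open>x n = j\<close> unfolding q_def by auto
  moreover have "q \<le> n"
    using permutes_in_image[OF x(1), of "Suc j"] j unfolding q_def by auto
  ultimately have "q < n"
    by simp
  have "q \<noteq> j"
    using xx[of "Suc j"] \<open>x j = n\<close> j unfolding q_def by auto
  have "card (inversions x) = Suc (card (inversions (s \<circ> x)))"
    unfolding s_def
    by (rule card_inversions_transpose_comp[OF x(1) \<open>q < n\<close>]) (simp_all add: q_def xx \<open>x n = j\<close>)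
  \<comment> \<open>The two products are inverse to each other, because \<open>s\<close> and
    \<open>x\<close> are involutions.\<close>
  also have "card (inversions (s \<circ> x)) = card (inversions (x \<circ> s))"
    using ss x(2) by (intro card_inversions_inverse) (metis comp_assoc comp_id id_comp)+
  also have "\<dots> = Suc (card (inversions (s \<circ> (x \<circ> s))))"
    unfolding s_def
  \<comment> \<open>Right multiplication moves the position of \<open>j + 1\<close> from
    \<open>q\<close> to \<open>s q\<close>, while \<open>n\<close> stays put because
    \<open>j + 1 < n\<close>.\<close>
  proof (rule card_inversions_transpose_comp[where b = "s q" and c = n])
    show "x \<circ> transpose j (Suc j) permutes {1..n}"
      using permutes_compose[OF s x(1)] unfolding s_def .
    show "s q < n"
      using \<open>q < n\<close> j by (auto simp: s_def transpose_def)
    show "(x \<circ> transpose j (Suc j)) (s q) = Suc j"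
      by (simp add: s_def q_def xx)
    show "(x \<circ> transpose j (Suc j)) n = j"
      using j \<open>x n = j\<close> by simp
  qed
  finally show ?thesis
    by (simp add: comp_assoc)
qed

text \<open>Conjugation by \<open>s\<close> is its own inverse and keeps the support size. Since
  \<open>s\<close> fixes \<open>n\<close>, the image of \<open>n\<close> moves from \<open>j\<close>
  to \<open>j + 1\<close>.\<close>

lemma card_involutions_shift:
  assumes j: "1 \<le> j" "Suc j < n"
  shows "card {x \<in> involutions n m l. x n = j} = card {x \<in> involutions n m (l - 2). x n = Suc j}"
proof (rule bij_betw_same_card)
  define s where "s = transpose j (Suc j)"
  define f where "f x = s \<circ> x \<circ> s" for x :: "nat \<Rightarrow> nat"
  have ss: "s (s i) = i" for i
    by (simp add: s_def)
  have s: "s permutes {1..n}"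
    unfolding s_def using j by (intro transpose_Suc_permutes) auto
  have ff: "f (f x) = x" for x
    by (auto simp: f_def fun_eq_iff ss)
  have f_n: "f x n = s (x n)" for x
    using j by (simp add: f_def s_def)
  have perm: "f x permutes {1..n}" if "x permutes {1..n}" for x
    unfolding f_def using s that by (intro permutes_compose)
  have invol: "f x \<circ> f x = id" if "x \<circ> x = id" for x
  proof -
    have "x (x i) = i" for i
      using that by (metis comp_apply id_apply)
    then show ?thesis
      by (auto simp: f_def fun_eq_iff ss)
  qed
  have supp: "card {i. f x i \<noteq> i} = card {i. x i \<noteq> i}" for x
  proof -
    have "bij_betw s {i. f x i \<noteq> i} {i. x i \<noteq> i}"
      by (rule bij_betw_byWitness[where f' = s]) (auto simp: f_def ss, (metis ss)+)
    then show ?thesis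
      by (rule bij_betw_same_card)
  qed
  have len: "card (inversions x) = card (inversions (f x)) + 2"
    if "x permutes {1..n}" "x \<circ> x = id" "x n = j" for x
    using card_inversions_conj[OF that(1,2) j that(3)] by (simp add: f_def s_def)
  have to: "f ` {x \<in> involutions n m l. x n = j} \<subseteq> {x \<in> involutions n m (l - 2). x n = Suc j}"
  proof safe
    fix x assume x: "x \<in> involutions n m l" "j = x n"
    show "f x \<in> involutions n m (l - 2)"
      using x perm[of x] invol[of x] len[of x] unfolding involutions_def by (auto simp: supp)
    show "f x n = Suc (x n)"
      unfolding f_n using x by (simp add: s_def)
  qed
  have from_f: "f ` {x \<in> involutions n m (l - 2). x n = Suc j} \<subseteq> {x \<in> involutions n m l. x n = j}"
  proof safe
    fix x assume x: "x \<in> involutions n m (l - 2)" "x n = Suc j"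
    show fxn: "f x n = j"
      unfolding f_n using x by (simp add: s_def)
    show "f x \<in> involutions n m l"
      using x perm[of x] invol[of x] len[of "f x"] fxn unfolding involutions_def
      by (auto simp: supp ff)
  qed
  show "bij_betw f {x \<in> involutions n m l. x n = j} {x \<in> involutions n m (l - 2). x n = Suc j}"
    by (rule bij_betw_byWitness[where f' = f]) (use to from_f in \<open>auto simp: ff\<close>)
qed

text \<open>Cancelling the last transposition removes two points from the support, hence the shift
  of \<open>m\<close> by 1; as its points are adjacent, only one inversion is lost.\<close>

lemma card_involutions_last_adjacent:
  "card {x \<in> involutions (Suc (Suc n)) m l. x (Suc (Suc n)) = Suc n} = card (involutions n (m - 1) (l - 1))"
proof (rule bij_betw_same_card)
  let ?N = "Suc (Suc n)" and ?M = "Suc n"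
  define s where "s = transpose ?M ?N"
  define f where "f x = s \<circ> x" for x :: "nat \<Rightarrow> nat"
  have ss: "s (s i) = i" for i
    by (simp add: s_def)
  have s: "s permutes {1..?N}"
    unfolding s_def by (intro transpose_Suc_permutes) auto
  have ff: "f (f x) = x" for x
    by (auto simp: f_def fun_eq_iff ss)
  have len: "card (inversions x) = Suc (card (inversions (f x)))"
    if "x permutes {1..?N}" "x ?M = ?N" "x ?N = ?M" for x
    using card_inversions_transpose_comp[OF that(1) _ that(2,3)] by (simp add: f_def s_def)
  have to: "f ` {x \<in> involutions ?N m l. x ?N = ?M} \<subseteq> involutions n (m - 1) (l - 1)"
  proof (rule image_subsetI)
    fix x assume "x \<in> {x \<in> involutions ?N m l. x ?N = ?M}"
    then have x: "x permutes {1..?N}" "x \<circ> x = id" "int (card {i. x i \<noteq> i}) = 2 * m"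
      "int (card (inversions x)) = l" "x ?N = ?M"
      by (auto simp: involutions_def)
    have xx: "x (x i) = i" for i
      using x(2) by (metis comp_apply id_apply)
    have "x ?M = ?N"
      using xx x(5) by metis
    have fx: "f x i = (if i = ?M \<or> i = ?N then i else x i)" for i
      using x(5) \<open>x ?M = ?N\<close> xx[of i] by (auto simp: f_def s_def transpose_def)
    have "f x permutes {1..?N}"
      unfolding f_def using x(1) s by (rule permutes_compose)
    then have perm: "f x permutes {1..n}"
      by (rule permutes_superset) (auto simp: fx)
    have invol: "f x \<circ> f x = id"
    proof
      fix i
      show "(f x \<circ> f x) i = id i"
        using xx[of i] x(5) \<open>x ?M = ?N\<close> by (auto simp: fx)
    qed
    have "{i. x i \<noteq> i} = insert ?M (insert ?N {i. f x i \<noteq> i})"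
      using x(5) \<open>x ?M = ?N\<close> by (auto simp: fx)
    moreover have "finite {i. f x i \<noteq> i}"
      using support_subset[OF perm] by (rule finite_subset) simp
    ultimately have "card {i. x i \<noteq> i} = card {i. f x i \<noteq> i} + 2"
      by (simp add: fx)
    then show "f x \<in> involutions n (m - 1) (l - 1)"
      using perm invol x len[OF x(1) \<open>x ?M = ?N\<close> x(5)] unfolding involutions_def by simp
  qed
  have from_f: "f ` involutions n (m - 1) (l - 1) \<subseteq> {x \<in> involutions ?N m l. x ?N = ?M}"
  proof (rule image_subsetI)
    fix y assume "y \<in> involutions n (m - 1) (l - 1)"
    then have y: "y permutes {1..n}" "y \<circ> y = id" "int (card {i. y i \<noteq> i}) = 2 * (m - 1)"
      "int (card (inversions y)) = l - 1"
      by (auto simp: involutions_def)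
    have yy: "y (y i) = i" for i
      using y(2) by (metis comp_apply id_apply)
    have yMN: "y ?M = ?M" "y ?N = ?N"
      using permutes_not_in[OF y(1)] by auto
    have fy: "f y i = (if i = ?M then ?N else if i = ?N then ?M else y i)" for i
      using yMN yy[of i] by (auto simp: f_def s_def transpose_def)
    have "y permutes {1..?N}"
      using y(1) by (rule permutes_subset) auto
    then have perm: "f y permutes {1..?N}"
      unfolding f_def using s by (rule permutes_compose)
    have invol: "f y \<circ> f y = id"
    proof
      fix i
      show "(f y \<circ> f y) i = id i"
        using yy[of i] yMN by (auto simp: fy)
    qed
    have "{i. f y i \<noteq> i} = insert ?M (insert ?N {i. y i \<noteq> i})"
      using yMN by (auto simp: fy)
    moreover have "finite {i. y i \<noteq> i}"
      using support_subset[OF y(1)] by (rule finite_subset) simp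
    ultimately have "card {i. f y i \<noteq> i} = card {i. y i \<noteq> i} + 2"
      by (simp add: yMN)
    then show "f y \<in> {x \<in> involutions ?N m l. x ?N = ?M}"
      using perm invol y len[OF perm] unfolding involutions_def by (simp add: ff fy)
  qed
  show "bij_betw f {x \<in> involutions ?N m l. x ?N = ?M} (involutions n (m - 1) (l - 1))"
    by (rule bij_betw_byWitness[where f' = f]) (use to from_f in \<open>auto simp: ff\<close>)
qed

text \<open>The image of \<open>n + 2\<close> is raised \<open>k - 1\<close> times, at a cost of 2
  each, until it is \<open>n + 1\<close>; the final cancellation costs 1. The total is
  \<open>2 * k - 1\<close>.\<close>

lemma card_involutions_last:
  assumes "1 \<le> k" "k \<le> Suc n"
  shows "card {x \<in> involutions (Suc (Suc n)) m l. x (Suc (Suc n)) = Suc (Suc n) - k} =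
    card (involutions n (m - 1) (l + 1 - 2 * int k))"
  using assms
proof (induction k arbitrary: l rule: dec_induct)
  case base
  then show ?case
    using card_involutions_last_adjacent[of n m l] by simp
next
  case (step k)
  have "card {x \<in> involutions (Suc (Suc n)) m l. x (Suc (Suc n)) = Suc (Suc n) - Suc k} =
    card {x \<in> involutions (Suc (Suc n)) m (l - 2). x (Suc (Suc n)) = Suc (Suc n) - k}"
    using card_involutions_shift[of "Suc n - k" "Suc (Suc n)" m l] step by (simp add: Suc_diff_le)
  then show ?case
    using step by (simp add: algebra_simps)
qed

lemma involutions_last_fixed:
  "{x \<in> involutions (Suc n) m l. x (Suc n) = Suc n} = involutions n m l"
proof -
  have "x permutes {1..Suc n} \<and> x (Suc n) = Suc n \<longleftrightarrow> x permutes {1..n}" for x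
  proof
    assume x: "x permutes {1..Suc n} \<and> x (Suc n) = Suc n"
    have "{1..Suc n} - {1..n} = {Suc n}"
      by auto
    then show "x permutes {1..n}"
      using x by (metis permutes_superset singletonD)
  next
    assume x: "x permutes {1..n}"
    then show "x permutes {1..Suc n} \<and> x (Suc n) = Suc n"
      using permutes_subset[OF x, of "{1..Suc n}"] permutes_not_in[OF x, of "Suc n"] by auto
  qed
  then show ?thesis
    unfolding involutions_def by auto
qed

text \<open>The classes are indexed by \<open>k = n - x n\<close>, and \<open>k = 0\<close> gives
  the first summand. The case \<open>n = 2\<close>, with the trivial group on the empty set, serves
  to compute \<open>L_series 2 1\<close>.\<close>

lemma alpha_recurrence:
  assumes "n \<ge> 2"
  shows "alpha n m l = alpha (n - 1) m l + (\<Sum>k=1..n-1. alpha (n - 2) (m - 1) (l + 1 - 2 * int k))"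
proof -
  obtain p where n: "n = Suc (Suc p)"
    using assms that[of "n - 2"] by simp
  define F where "F k = {x \<in> involutions n m l. x n = n - k}" for k
  have "involutions n m l = (\<Union>k\<in>{0..n-1}. F k)"
  proof
    show "involutions n m l \<subseteq> (\<Union>k\<in>{0..n-1}. F k)"
    proof
      fix x assume x: "x \<in> involutions n m l"
      then have "x n \<in> {1..n}"
        using permutes_in_image[of x "{1..n}" n] assms by (simp add: involutions_def)
      then show "x \<in> (\<Union>k\<in>{0..n-1}. F k)"
        using x by (intro UN_I[of "n - x n"]) (auto simp: F_def)
    qed
  qed (auto simp: F_def)
  moreover have "finite (F k)" for k
    unfolding F_def using finite_involutions by simp
  moreover have "F i \<inter> F j = {}" if "i \<in> {0..n-1}" "j \<in> {0..n-1}" "i \<noteq> j" for i j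
    using that unfolding F_def by auto
  ultimately have "card (involutions n m l) = (\<Sum>k=0..n-1. card (F k))"
    by (simp add: card_UN_disjoint)
  also have "\<dots> = card (F 0) + (\<Sum>k=1..n-1. card (F k))"
    by (simp add: sum.atLeast_Suc_atMost)
  also have "F 0 = involutions (n - 1) m l"
    using involutions_last_fixed[of "n - 1" m l] by (simp add: F_def n)
  also have "(\<Sum>k=1..n-1. card (F k)) =
      (\<Sum>k=1..n-1. card (involutions (n - 2) (m - 1) (l + 1 - 2 * int k)))"
    using card_involutions_last[of _ p m l] by (intro sum.cong) (auto simp: F_def n)
  finally show ?thesis
    by (simp add: alpha_eq_card_involutions)
qed

section \<open>Generating functions\<close>

lemma L_series_zero: "L_series n 0 = 1"
  by (auto simp: L_series_def fps_eq_iff alpha_zero)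

lemma L_series_eq_0:
  assumes "int n < 2 * m"
  shows "L_series n m = 0"
  using assms by (simp add: L_series_def fps_eq_iff alpha_eq_0_if_lt_double)

text \<open>The product of the odd powers with the denominator telescopes; the denominator has
  constant term -1, so it is nonzero and cancels.\<close>

lemma geometric_quotient:
  "fps_X * (fps_X ^ (2 * p) - 1) / (fps_X ^ 2 - 1) = (\<Sum>k=1..p. fps_X ^ (2 * k - 1) :: rat fps)"
proof -
  have "fps_X * (fps_X ^ (2 * p) - 1) = (\<Sum>k=1..p. fps_X ^ (2 * k - 1)) * (fps_X ^ 2 - 1 :: rat fps)"
  proof (induction p)
    case (Suc p)
    have "(\<Sum>k=1..Suc p. fps_X ^ (2 * k - 1)) * (fps_X ^ 2 - 1 :: rat fps) =
        fps_X * (fps_X ^ (2 * p) - 1) + fps_X * fps_X ^ (2 * p) * (fps_X ^ 2 - 1)"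
      by (simp add: Suc.IH distrib_right)
    also have "\<dots> = fps_X * (fps_X ^ (2 * Suc p) - 1)"
      by (simp add: algebra_simps power2_eq_square)
    finally show ?case ..
  qed simp
  moreover have "(fps_X ^ 2 - 1 :: rat fps) \<noteq> 0"
  proof
    assume "(fps_X ^ 2 - 1 :: rat fps) = 0"
    then have "fps_nth (fps_X ^ 2 - 1 :: rat fps) 0 = 0"
      by simp
    then show False
      by simp
  qed
  ultimately show ?thesis
    by simp
qed

text \<open>Multiplication by an odd power of \<open>fps_X\<close> performs the length shift of one
  class, so the recurrence for the numbers can be read off coefficientwise.\<close>

lemma L_series_recurrence:
  assumes "n \<ge> 2"
  shows "L_series n m = L_series (n - 1) m +
    fps_X * (fps_X ^ (2 * n - 2) - 1) / (fps_X ^ 2 - 1) * L_series (n - 2) (m - 1)"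
proof -
  have shift: "fps_nth (fps_X ^ (2 * k - 1) * L_series (n - 2) (m - 1)) l =
      of_nat (alpha (n - 2) (m - 1) (int l + 1 - 2 * int k))" if "1 \<le> k" for k l
  proof (cases "l < 2 * k - 1")
    \<comment> \<open>Both sides vanish: the coefficient lies below the shift, and the length on the
      right is negative.\<close>
    case True
    then show ?thesis
      using that by (simp add: fps_X_power_mult_nth alpha_eq_0_if_neg)
  next
    case False
    then have "int (l - (2 * k - 1)) = int l + 1 - 2 * int k"
      using that by simp
    moreover have "fps_nth (fps_X ^ (2 * k - 1) * L_series (n - 2) (m - 1)) l =
        of_nat (alpha (n - 2) (m - 1) (int (l - (2 * k - 1))))"
      using False by (simp add: fps_X_power_mult_nth L_series_def)
    ultimately show ?thesis
      by (simp only:)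
  qed
  have "L_series n m = L_series (n - 1) m +
      (\<Sum>k=1..n-1. fps_X ^ (2 * k - 1)) * L_series (n - 2) (m - 1)"
  proof (rule fps_ext)
    fix l
    have "fps_nth (L_series n m) l = of_nat (alpha (n - 1) m (int l)) +
        (\<Sum>k=1..n-1. of_nat (alpha (n - 2) (m - 1) (int l + 1 - 2 * int k)))"
      using alpha_recurrence[OF assms, of m "int l"] by (simp add: L_series_def)
    also have "\<dots> = fps_nth (L_series (n - 1) m) l +
        (\<Sum>k=1..n-1. fps_nth (fps_X ^ (2 * k - 1) * L_series (n - 2) (m - 1)) l)"
      by (intro arg_cong2[of _ _ _ _ "(+)"] sum.cong shift[symmetric]) (auto simp: L_series_def)
    finally show "fps_nth (L_series n m) l = fps_nth (L_series (n - 1) m +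
        (\<Sum>k=1..n-1. fps_X ^ (2 * k - 1)) * L_series (n - 2) (m - 1)) l"
      by (simp add: sum_distrib_right fps_sum_nth)
  qed
  then show ?thesis
    using geometric_quotient[of "n - 1"] by (simp add: diff_mult_distrib2)
qed

text \<open>The recurrence at \<open>n = 2\<close>, where the first term is 0, the last series is 1
  and the quotient reduces to \<open>fps_X\<close>.\<close>

lemma L_series_2_1: "L_series 2 1 = fps_X"
proof -
  have "fps_X * (fps_X ^ 2 - 1) / (fps_X ^ 2 - 1) = (fps_X :: rat fps)"
    using geometric_quotient[of 1] by simp
  then show ?thesis
    using L_series_recurrence[of 2 1] L_series_eq_0[of 1 1] by (simp add: L_series_zero)
qed

theorem theorem1p1:
  shows "(\<forall>(n::nat) (m::int) (l::int). n \<ge> 3 \<and> m \<ge> 1 \<longrightarrow>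
            (l < m \<longrightarrow> alpha n m l = 0) \<and>
            (l \<ge> m \<longrightarrow> alpha n m l =
               alpha (n - 1) m l + (\<Sum>k=1..n-1. alpha (n - 2) (m - 1) (l + 1 - 2 * int k)))) \<and>
         (\<forall>n::nat. n \<ge> 1 \<longrightarrow> L_series n 0 = 1) \<and>
         L_series 1 1 = 0 \<and>
         L_series 2 1 = fps_X \<and>
         (\<forall>(n::nat) (m::int). n \<ge> 1 \<and> int n < 2 * m \<longrightarrow> L_series n m = 0) \<and>
         (\<forall>(n::nat) (m::int). n \<ge> 1 \<and> m \<ge> 1 \<and> (n, m) \<noteq> (1, 1) \<and> (n, m) \<noteq> (2, 1) \<and>
            \<not> int n < 2 * m \<longrightarrow>
            L_series n m = L_series (n - 1) m +
              fps_X * (fps_X ^ (2 * n - 2) - 1) / (fps_X ^ 2 - 1) * L_series (n - 2) (m - 1))"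
proof (intro conjI allI impI)
  fix n :: nat and m :: int
  assume "1 \<le> n \<and> 1 \<le> m \<and> (n, m) \<noteq> (1, 1) \<and> (n, m) \<noteq> (2, 1) \<and> \<not> int n < 2 * m"
  then show "L_series n m = L_series (n - 1) m +
      fps_X * (fps_X ^ (2 * n - 2) - 1) / (fps_X ^ 2 - 1) * L_series (n - 2) (m - 1)"
    \<comment> \<open>The bound \<open>n \<ge> 2\<close> follows from \<open>n \<ge> 2 * m\<close>
      and \<open>m \<ge> 1\<close>.\<close>
    by (intro L_series_recurrence) auto
qed (auto simp: alpha_eq_0_if_less alpha_recurrence L_series_zero L_series_eq_0 L_series_2_1)

end
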